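(* For every metric space $(M,d)$, opening cost $f>0$ and demand sequence $u_1,\dots,u_n$, the total cost of the algorithm PD-SumRad is at most $3\,(2+\log_2 n)$ times the minimum cost of an offline solution in which every cluster has radius $2^k f$ for some integer $k\ge 0$.
   Context: Online Sum-Radii Clustering: demands $u_1,\dots,u_n\in M$ arrive one by one; if an arriving demand is not contained in an open cluster, the algorithm must irrevocably open a cluster $C(p,r)=\{v\in M: d(p,v)\le r\}$ containing it, at cost $f+r$. An offline solution is a collection of clusters $C(p_i,r_i)$ covering all demands, with cost $\sum_i (f+r_i)$. Let $r_k=2^k f$ for integers $k\ge 0$, $r_{-1}=0$, and $N=\{-1,0,1,2,\dots\}$. Algorithm PD-SumRad maintains a value $a_j\ge 0$ for each processed demand. When $u_j$ arrives: if $u_j$ lies in an already opened cluster, set $a_j=0$. Otherwise set $a_j=f$; call a pair $(z,k)\in M\times N$ tight if $\sum_{i\le j:\,d(u_i,z)\le r_k} a_i = f+r_k$; let $k$ be the maximum element of $N$ such that some $z\in M$ with $d(u_j,z)\le r_k$ makes $(z,k)$ tight (such pairs exist, e.g. $(u_j,-1)$), and open the cluster $C(z,3r_k)$ for such a $z$, assigning $u_j$ to it. *)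

theory Defs
  imports "HOL-Analysis.Analysis"
begin

text \<open>
  Demands are the values \<open>u 1, \<dots>, u n\<close> of a function \<open>u\<close>; the index set \<open>N = {-1, 0, 1, \<dots>}\<close> is
  \<open>{-1..} :: int set\<close>; the cluster \<open>C(p,r)\<close> is the closed ball \<open>mcball p r\<close>.
\<close>

locale online_sum_radii = Metric_space M d
  for M :: "'a set" and d :: "'a \<Rightarrow> 'a \<Rightarrow> real" +
  fixes f :: real
  assumes f_pos: "0 < f"
begin

definition rad :: "int \<Rightarrow> real" where
  "rad k = (if k < 0 then 0 else 2 ^ nat k * f)"

definition tight :: "(nat \<Rightarrow> 'a) \<Rightarrow> (nat \<Rightarrow> real) \<Rightarrow> nat \<Rightarrow> 'a \<Rightarrow> int \<Rightarrow> bool" where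
  "tight u a j z k \<longleftrightarrow> (\<Sum>i | i \<in> {1..j} \<and> d (u i) z \<le> rad k. a i) = f + rad k"

definition eligible :: "(nat \<Rightarrow> 'a) \<Rightarrow> (nat \<Rightarrow> real) \<Rightarrow> nat \<Rightarrow> 'a \<Rightarrow> int \<Rightarrow> bool" where
  "eligible u a j z k \<longleftrightarrow> z \<in> M \<and> k \<in> {-1..} \<and> d (u j) z \<le> rad k \<and> tight u a j z k"

text \<open>
  \<open>c j\<close> is the cluster (centre and radius) opened on the arrival of \<open>u j\<close>, and \<open>None\<close> if no cluster
  is opened then.
\<close>

definition covered_by :: "(nat \<Rightarrow> ('a \<times> real) option) \<Rightarrow> nat set \<Rightarrow> 'a \<Rightarrow> bool" where
  "covered_by c I v \<longleftrightarrow> (\<exists>i\<in>I. \<exists>p r. c i = Some (p, r) \<and> v \<in> mcball p r)"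

definition pd_step ::
  "(nat \<Rightarrow> 'a) \<Rightarrow> (nat \<Rightarrow> real) \<Rightarrow> (nat \<Rightarrow> ('a \<times> real) option) \<Rightarrow> nat \<Rightarrow> bool" where
  "pd_step u a c j \<longleftrightarrow>
     (if covered_by c {1..<j} (u j) then a j = 0 \<and> c j = None
      else a j = f \<and>
        (\<exists>z k. eligible u a j z k \<and> (\<forall>z' k'. eligible u a j z' k' \<longrightarrow> k' \<le> k) \<and>
               c j = Some (z, 3 * rad k)))"

text \<open>
  PD-SumRad leaves the choice of \<open>z\<close> open, so its executions form a relation: \<open>pd_run n u a c\<close>
  says that \<open>a\<close> and \<open>c\<close> record a possible execution on \<open>u 1, \<dots>, u n\<close>.
\<close>

definition pd_run ::
  "nat \<Rightarrow> (nat \<Rightarrow> 'a) \<Rightarrow> (nat \<Rightarrow> real) \<Rightarrow> (nat \<Rightarrow> ('a \<times> real) option) \<Rightarrow> bool" where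
  "pd_run n u a c \<longleftrightarrow> (\<forall>j\<in>{1..n}. pd_step u a c j)"

definition pd_cost :: "nat \<Rightarrow> (nat \<Rightarrow> ('a \<times> real) option) \<Rightarrow> real" where
  "pd_cost n c = (\<Sum>j=1..n. case c j of None \<Rightarrow> 0 | Some (p, r) \<Rightarrow> f + r)"

definition offline_solution :: "nat \<Rightarrow> (nat \<Rightarrow> 'a) \<Rightarrow> ('a \<times> real) list \<Rightarrow> bool" where
  "offline_solution n u S \<longleftrightarrow>
     (\<forall>(p, r)\<in>set S. p \<in> M \<and> 0 \<le> r) \<and> (\<forall>j\<in>{1..n}. \<exists>(p, r)\<in>set S. u j \<in> mcball p r)"

definition offline_cost :: "('a \<times> real) list \<Rightarrow> real" where
  "offline_cost S = (\<Sum>(p, r)\<leftarrow>S. f + r)"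

definition pow2_radii :: "('a \<times> real) list \<Rightarrow> bool" where
  "pow2_radii S \<longleftrightarrow> (\<forall>(p, r)\<in>set S. \<exists>k::nat. r = 2 ^ k * f)"

text \<open>This infimum is a minimum: see \<open>pow2_opt_attained\<close> below.\<close>

definition pow2_opt :: "nat \<Rightarrow> (nat \<Rightarrow> 'a) \<Rightarrow> real" where
  "pow2_opt n u = Inf (offline_cost ` {S. offline_solution n u S \<and> pow2_radii S})"

lemma offline_cost_multiple:
  "pow2_radii S \<Longrightarrow> \<exists>m::nat. offline_cost S = f * real m"
proof (induction S)
  case Nil
  then show ?case by (auto simp: offline_cost_def)
next
  case (Cons x S)
  obtain p r where x: "x = (p, r)" by fastforce
  obtain m where m: "offline_cost S = f * real m"
    using Cons by (auto simp: pow2_radii_def)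
  obtain k :: nat where "r = 2 ^ k * f"
    using Cons.prems x by (auto simp: pow2_radii_def)
  then have "offline_cost (x # S) = f * real (1 + 2 ^ k + m)"
    using m x by (simp add: offline_cost_def algebra_simps)
  then show ?case by blast
qed

lemma pow2_opt_attained:
  assumes u: "u \<in> {1..n} \<rightarrow> M"
  obtains S where "offline_solution n u S" "pow2_radii S" "offline_cost S = pow2_opt n u"
    "\<And>T. offline_solution n u T \<Longrightarrow> pow2_radii T \<Longrightarrow> offline_cost S \<le> offline_cost T"
proof -
  define P where "P m \<longleftrightarrow>
    (\<exists>S. offline_solution n u S \<and> pow2_radii S \<and> offline_cost S = f * real m)" for m :: nat
  define S0 where "S0 = map (\<lambda>j. (u j, f)) [1..<Suc n]"
  have set_S0: "set S0 = (\<lambda>j. (u j, f)) ` {1..n}"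
    unfolding S0_def by (simp add: atLeastLessThanSuc_atLeastAtMost del: upt_Suc)
  then have "pow2_radii S0"
    by (auto simp: pow2_radii_def intro: exI[of _ "0::nat"])
  moreover have "offline_solution n u S0"
    unfolding offline_solution_def
  proof (intro conjI ballI)
    show "case x of (p, r) \<Rightarrow> p \<in> M \<and> 0 \<le> r" if "x \<in> set S0" for x
      using that u f_pos by (auto simp: set_S0 Pi_iff)
    show "\<exists>(p, r)\<in>set S0. u j \<in> mcball p r" if j: "j \<in> {1..n}" for j
    proof (rule bexI)
      show "(u j, f) \<in> set S0" using j by (auto simp: set_S0)
      show "case (u j, f) of (p, r) \<Rightarrow> u j \<in> mcball p r"
        using u j f_pos by (auto simp: Pi_iff)
    qed
  qed
  ultimately have "\<exists>m. P m"
    using offline_cost_multiple unfolding P_def by blast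
  then have "P (LEAST m. P m)" by (rule LeastI_ex)
  then obtain S where S: "offline_solution n u S" "pow2_radii S"
      "offline_cost S = f * real (LEAST m. P m)"
    unfolding P_def by blast
  have min: "offline_cost S \<le> offline_cost T" if T: "offline_solution n u T" "pow2_radii T" for T
  proof -
    obtain m where m: "offline_cost T = f * real m"
      using T offline_cost_multiple by blast
    then have "P m" using T unfolding P_def by blast
    then have "(LEAST m. P m) \<le> m" by (rule Least_le)
    then show ?thesis using S(3) m f_pos by simp
  qed
  have "pow2_opt n u = offline_cost S"
    unfolding pow2_opt_def
  proof (rule cInf_eq_minimum)
    show "offline_cost S \<in> offline_cost ` {S. offline_solution n u S \<and> pow2_radii S}"
      using S(1,2) by blast
  qed (use min in blast)
  then show thesis using that S min by metis
qed

text \<open>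
  The remaining lemmas show that an execution always exists, that is, that the maximum in
  \<open>pd_step\<close> is well defined.
\<close>

definition load :: "(nat \<Rightarrow> 'a) \<Rightarrow> (nat \<Rightarrow> real) \<Rightarrow> nat \<Rightarrow> 'a \<Rightarrow> int \<Rightarrow> real" where
  "load u a j z k = (\<Sum>i | i \<in> {1..j} \<and> d (u i) z \<le> rad k. a i)"

lemma load_0 [simp]: "load u a 0 z k = 0"
  by (simp add: load_def)

lemma load_Suc:
  "load u a (Suc n) z k = load u a n z k + (if d (u (Suc n)) z \<le> rad k then a (Suc n) else 0)"
proof -
  have "{i. i \<in> {1..Suc n} \<and> d (u i) z \<le> rad k} =
    (if d (u (Suc n)) z \<le> rad k then insert (Suc n) {i. i \<in> {1..n} \<and> d (u i) z \<le> rad k}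
     else {i. i \<in> {1..n} \<and> d (u i) z \<le> rad k})"
    by (auto simp: le_Suc_eq)
  then show ?thesis by (auto simp: load_def)
qed

lemma rad_multiple: "\<exists>m::nat. f + rad k = f * real m"
proof (cases "k < 0")
  case True
  then have "f + rad k = f * real 1" by (simp add: rad_def)
  then show ?thesis by blast
next
  case False
  then have "f + rad k = f * real (1 + 2 ^ nat k)"
    by (simp add: rad_def algebra_simps)
  then show ?thesis by blast
qed

lemma pd_run_Suc: "pd_run (Suc n) u a c \<longleftrightarrow> pd_run n u a c \<and> pd_step u a c (Suc n)"
proof -
  have "{1..Suc n} = insert (Suc n) {1..n}" by auto
  then show ?thesis unfolding pd_run_def by (simp only: ball_simps conj_commute)
qed

lemma load_multiple:
  "pd_run n u a c \<Longrightarrow> \<exists>m\<le>n. load u a n z k = f * real m"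
proof (induction n)
  case 0
  then show ?case by simp
next
  case (Suc n)
  then obtain m where m: "m \<le> n" "load u a n z k = f * real m"
    by (auto simp: pd_run_Suc)
  have "a (Suc n) = 0 \<or> a (Suc n) = f"
    using Suc.prems by (auto simp: pd_run_Suc pd_step_def split: if_splits)
  then have "load u a (Suc n) z k = f * real m \<or> load u a (Suc n) z k = f * real (Suc m)"
    using m by (auto simp: load_Suc algebra_simps)
  then show ?case
    using m(1) by (meson Suc_le_mono le_SucI)
qed

lemma load_bound:
  assumes "pd_run n u a c" "u \<in> {1..n} \<rightarrow> M" "z \<in> M" "k \<in> {-1..}"
  shows "load u a n z k \<le> f + rad k \<and>
    (load u a n z k = f + rad k \<longrightarrow> (\<forall>v\<in>M. d v z \<le> rad k \<longrightarrow> covered_by c {1..n} v))"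
  using assms
proof (induction n)
  case 0
  have "0 \<le> rad k" using f_pos by (simp add: rad_def)
  then show ?case using f_pos by simp
next
  case (Suc n)
  have run: "pd_run n u a c" and step: "pd_step u a c (Suc n)"
    using Suc.prems by (auto simp: pd_run_Suc)
  have uM: "u \<in> {1..n} \<rightarrow> M" "u (Suc n) \<in> M" using Suc.prems by (auto simp: Pi_iff)
  have IH: "load u a n z k \<le> f + rad k"
    "\<And>v. load u a n z k = f + rad k \<Longrightarrow> v \<in> M \<Longrightarrow> d v z \<le> rad k \<Longrightarrow> covered_by c {1..n} v"
    using Suc.IH run uM Suc.prems by auto
  have mono: "covered_by c {1..n} v \<Longrightarrow> covered_by c {1..Suc n} v" for v
    unfolding covered_by_def by fastforce
  have atl: "{1..<Suc n} = {1..n}" by auto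
  show ?case
  proof (cases "covered_by c {1..n} (u (Suc n)) \<or> \<not> d (u (Suc n)) z \<le> rad k")
    case True
    then have "load u a (Suc n) z k = load u a n z k"
      using step by (auto simp: load_Suc pd_step_def atl simp del: One_nat_def)
    then show ?thesis using IH mono by auto
  next
    case False
    then have a: "a (Suc n) = f" and near: "d (u (Suc n)) z \<le> rad k"
      using step by (auto simp: pd_step_def atl simp del: One_nat_def)
    have ne: "load u a n z k \<noteq> f + rad k" using IH(2) uM False by blast
    obtain m where m: "load u a n z k = f * real m" using load_multiple[OF run] by blast
    obtain l where l: "f + rad k = f * real l" using rad_multiple by blast
    have "m < l" using IH(1) ne m l f_pos by (auto simp: order_less_le)
    then have "f * real (Suc m) \<le> f * real l" using f_pos by simp
    then have le: "load u a (Suc n) z k \<le> f + rad k"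
      using near a m l by (simp add: load_Suc algebra_simps)
    have "covered_by c {1..Suc n} v"
      if eq: "load u a (Suc n) z k = f + rad k" and v: "v \<in> M" "d v z \<le> rad k" for v
    proof -
      have "eligible u a (Suc n) z k"
        using eq near Suc.prems by (simp add: eligible_def tight_def load_def)
      then obtain z' k' where e: "eligible u a (Suc n) z' k'" "k \<le> k'"
          "c (Suc n) = Some (z', 3 * rad k')"
        using step False by (auto simp: pd_step_def atl simp del: One_nat_def)
      then have z': "z' \<in> M" "d (u (Suc n)) z' \<le> rad k'" by (auto simp: eligible_def)
      have "rad k \<le> rad k'" using e(2) f_pos by (auto simp: rad_def intro!: power_increasing)
      moreover have "d z' v \<le> d z' (u (Suc n)) + d (u (Suc n)) z + d z v"
        using triangle[of z' "u (Suc n)" z] triangle[of z' z v] uM z' v Suc.prems by auto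
      ultimately have "d z' v \<le> 3 * rad k'"
        using z' near v by (simp add: commute)
      then have "v \<in> mcball z' (3 * rad k')" using z' v by simp
      then show ?thesis using e(3) unfolding covered_by_def by fastforce
    qed
    then show ?thesis using le by blast
  qed
qed

lemma pd_step_cong:
  assumes "\<And>i. i \<in> {1..j} \<Longrightarrow> a i = a' i" "\<And>i. i \<in> {1..j} \<Longrightarrow> c i = c' i" "1 \<le> j"
  shows "pd_step u a c j = pd_step u a' c' j"
proof -
  have "tight u a j z k = tight u a' j z k" for z k
    unfolding tight_def using sum.cong[of "{i. i \<in> {1..j} \<and> d (u i) z \<le> rad k}" _ a a'] assms(1)
    by simp
  moreover have "covered_by c {1..<j} v = covered_by c' {1..<j} v" for v
    unfolding covered_by_def using assms(2) by (intro bex_cong) auto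
  ultimately show ?thesis
    using assms by (auto simp: pd_step_def eligible_def)
qed

lemma pd_run_exists:
  assumes "u \<in> {1..n} \<rightarrow> M"
  shows "\<exists>a c. pd_run n u a c"
  using assms
proof (induction n)
  case 0
  then show ?case by (simp add: pd_run_def)
next
  case (Suc n)
  have uM: "u \<in> {1..n} \<rightarrow> M" "u (Suc n) \<in> M" using Suc.prems by (auto simp: Pi_iff)
  then obtain a c where run: "pd_run n u a c" using Suc.IH by blast
  have ext: "pd_run n u (a(Suc n := x)) (c(Suc n := y))" for x y
    unfolding pd_run_def
  proof
    fix j assume j: "j \<in> {1..n}"
    then have "pd_step u (a(Suc n := x)) (c(Suc n := y)) j = pd_step u a c j"
      by (intro pd_step_cong) auto
    then show "pd_step u (a(Suc n := x)) (c(Suc n := y)) j"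
      using run j by (simp add: pd_run_def)
  qed
  have atl: "{1..<Suc n} = {1..n}" by auto
  have cov: "covered_by (c(Suc n := y)) {1..n} v = covered_by c {1..n} v" for y v
    unfolding covered_by_def by (intro bex_cong) auto
  show ?case
  proof (cases "covered_by c {1..n} (u (Suc n))")
    case True
    then have "pd_step u (a(Suc n := 0)) (c(Suc n := None)) (Suc n)"
      by (simp add: pd_step_def atl cov del: One_nat_def)
    then have "pd_run (Suc n) u (a(Suc n := 0)) (c(Suc n := None))"
      using ext by (simp only: pd_run_Suc simp_thms)
    then show ?thesis by (intro exI)
  next
    case False
    define b where "b = a(Suc n := f)"
    define K where "K = {k. \<exists>z. eligible u b (Suc n) z k}"
    have b: "load u b n z k = load u a n z k" for z k
      unfolding load_def b_def by (rule sum.cong) auto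
    have "load u a n (u (Suc n)) (-1) = 0"
    proof -
      have "load u a n (u (Suc n)) (-1) \<le> f" "load u a n (u (Suc n)) (-1) \<noteq> f"
        using load_bound[OF run uM, of "-1"] False uM by (auto simp: rad_def)
      moreover obtain m where "load u a n (u (Suc n)) (-1) = f * real m"
        using load_multiple[OF run] by blast
      ultimately show ?thesis using f_pos by (cases m) (auto simp: algebra_simps mult_le_0_iff)
    qed
    then have "load u b (Suc n) (u (Suc n)) (-1) = f"
      using uM b by (simp add: load_Suc rad_def b_def)
    then have "eligible u b (Suc n) (u (Suc n)) (-1)"
      using uM by (simp add: eligible_def tight_def load_def rad_def)
    then have ne: "K \<noteq> {}" unfolding K_def by blast
    have "k \<in> {-1..int n}" if kK: "k \<in> K" for k
    proof -
      obtain z where e: "eligible u b (Suc n) z k" using kK unfolding K_def by blast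
      then have "f + rad k = load u a n z k + f"
        using b[of z k] load_Suc[of u b n z k]
        by (simp only: eligible_def tight_def load_def[symmetric]) (auto simp: b_def)
      moreover obtain m where "m \<le> n" "load u a n z k = f * real m"
        using load_multiple[OF run] by blast
      ultimately have *: "rad k = f * real m" "m \<le> n" by auto
      have "k \<le> int n"
      proof (rule ccontr)
        assume "\<not> k \<le> int n"
        then have "2 ^ nat k = real m" "n < nat k" using * f_pos by (auto simp: rad_def)
        have "real (nat k) < 2 ^ nat k" by (rule of_nat_less_two_power)
        then show False using \<open>2 ^ nat k = real m\<close> \<open>n < nat k\<close> \<open>m \<le> n\<close> by linarith
      qed
      then show ?thesis using e by (simp add: eligible_def)
    qed
    then have fin: "finite K" by (meson finite_atLeastAtMost_int finite_subset subsetI)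
    then have "Max K \<in> K" using ne by simp
    then obtain z where z: "eligible u b (Suc n) z (Max K)" unfolding K_def by blast
    have "k' \<le> Max K" if "eligible u b (Suc n) z' k'" for z' k'
      using that fin unfolding K_def by (auto intro: Max_ge)
    then have "pd_step u b (c(Suc n := Some (z, 3 * rad (Max K)))) (Suc n)"
      using z False by (auto simp: pd_step_def atl cov b_def simp del: One_nat_def)
    then have "pd_run (Suc n) u b (c(Suc n := Some (z, 3 * rad (Max K))))"
      using ext by (simp only: pd_run_Suc b_def simp_thms)
    then show ?thesis by (intro exI)
  qed
qed

end

end

theory Submission
  imports Defs
begin

text \<open>
  The values \<open>a i\<close> form a feasible dual solution: no pair is ever loaded beyond \<open>f + rad k\<close>, so
  their sum is at most the offline cost. Each opened cluster is paid for, up to the factor 3, by the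
  values inside its tight pair. Two tight pairs of the same level that share a demand would put the
  later opening demand into the earlier cluster, whose radius was tripled; so each value pays at most
  once per level, and only the levels with \<open>2 ^ k \<le> n\<close> and the level \<open>-1\<close> can become tight.
\<close>

context online_sum_radii
begin

lemma pd_run_value:
  "pd_run n u a c \<Longrightarrow> i \<in> {1..n} \<Longrightarrow> a i = 0 \<or> a i = f"
  by (auto simp: pd_run_def pd_step_def split: if_splits)

lemma pd_run_prefix: "pd_run n u a c \<Longrightarrow> j \<le> n \<Longrightarrow> pd_run j u a c"
  by (auto simp: pd_run_def)

text \<open>Weak duality. A cluster of radius \<open>rad k\<close> with \<open>k\<close> \<ge> 0
  contains values of total at most \<open>f + rad k\<close>, its own cost, by
  \<open>load_bound\<close> at the end of the run. Adding this up over the clusters of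
  \<open>S\<close> counts every demand at least once, and the values are nonnegative.\<close>

lemma sum_values_le_offline_cost:
  assumes run: "pd_run n u a c" and u: "u \<in> {1..n} \<rightarrow> M"
    and S: "offline_solution n u S" "pow2_radii S"
  shows "(\<Sum>i=1..n. a i) \<le> offline_cost S"
proof -
  have nonneg: "0 \<le> a i" if "i \<in> {1..n}" for i
    using pd_run_value[OF run that] f_pos by auto
  \<comment> \<open>Induction over \<open>S\<close> itself would fail, since its tails need not
    cover all demands. Hence the sum is restricted to the demands covered by
    \<open>T\<close>.\<close>
  have "(\<Sum>i | i \<in> {1..n} \<and> (\<exists>(p, r)\<in>set T. u i \<in> mcball p r). a i) \<le> offline_cost T"
    if "set T \<subseteq> set S" for T
    using that
  proof (induction T)
    case Nil
    then show ?case by (simp add: offline_cost_def)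
  next
    case (Cons x T)
    obtain p r where x: "x = (p, r)" by fastforce
    let ?A = "{i. i \<in> {1..n} \<and> u i \<in> mcball p r}"
    let ?B = "{i. i \<in> {1..n} \<and> (\<exists>(p, r)\<in>set T. u i \<in> mcball p r)}"
    have p: "p \<in> M" using Cons.prems S x by (auto simp: offline_solution_def)
    obtain k :: nat where k: "r = rad (int k)"
      using Cons.prems S x by (fastforce simp: pow2_radii_def rad_def)
    have "?A = {i. i \<in> {1..n} \<and> d (u i) p \<le> rad (int k)}"
      using p u by (auto simp: k commute Pi_iff)
    then have A: "sum a ?A \<le> f + r"
      using load_bound[OF run u p, of "int k"] by (simp add: load_def k)
    have "{i. i \<in> {1..n} \<and> (\<exists>(p, r)\<in>set (x # T). u i \<in> mcball p r)} = ?A \<union> ?B"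
      using x by auto
    moreover have "sum a (?A \<union> ?B) \<le> sum a ?A + sum a ?B"
      using sum.union_inter[of ?A ?B a] sum_nonneg[of "?A \<inter> ?B" a] nonneg by auto
    ultimately show ?case
      using A Cons x by (simp add: offline_cost_def)
  qed
  from this[of S] have "(\<Sum>i | i \<in> {1..n} \<and> (\<exists>(p, r)\<in>set S. u i \<in> mcball p r). a i) \<le> offline_cost S"
    by simp
  moreover have "{i. i \<in> {1..n} \<and> (\<exists>(p, r)\<in>set S. u i \<in> mcball p r)} = {1..n}"
    using S by (auto simp: offline_solution_def)
  ultimately show ?thesis by simp
qed

text \<open>Each of the first \<open>j\<close> demands has value 0 or \<open>f\<close>, so a tight
  pair needs exactly \<open>1 + 2 ^ nat k\<close> demands of value \<open>f\<close> among
  them.\<close>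

lemma tight_level_le:
  assumes "pd_run j u a c" "tight u a j z k" "0 \<le> k"
  shows "2 ^ nat k \<le> j"
proof -
  obtain m where "m \<le> j" "load u a j z k = f * real m"
    using load_multiple[OF assms(1)] by blast
  then have "f * (1 + 2 ^ nat k) = f * real m" "m \<le> j"
    using assms by (auto simp: tight_def load_def rad_def algebra_simps)
  then have "real (1 + 2 ^ nat k) = real m" using f_pos by simp
  then show ?thesis using \<open>m \<le> j\<close> by linarith
qed

theorem pd_cost_le_pow2_opt:
  assumes run: "pd_run n u a c" and u: "u \<in> {1..n} \<rightarrow> M" and n: "1 \<le> n"
  shows "pd_cost n c \<le> 3 * (2 + log 2 (real n)) * pow2_opt n u"
proof -
  define J where "J = {j \<in> {1..n}. c j \<noteq> None}"
  have "\<forall>j\<in>J. \<exists>zk. eligible u a j (fst zk) (snd zk) \<and> c j = Some (fst zk, 3 * rad (snd zk)) \<and>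
      \<not> covered_by c {1..<j} (u j)"
  proof
    fix j assume "j \<in> J"
    then have step: "pd_step u a c j" "c j \<noteq> None" using run by (auto simp: J_def pd_run_def)
    then have uncov: "\<not> covered_by c {1..<j} (u j)" by (auto simp: pd_step_def)
    then obtain z k where "eligible u a j z k" "c j = Some (z, 3 * rad k)"
      using step by (auto simp: pd_step_def)
    then show "\<exists>zk. eligible u a j (fst zk) (snd zk) \<and> c j = Some (fst zk, 3 * rad (snd zk)) \<and>
        \<not> covered_by c {1..<j} (u j)"
      using uncov by (intro exI[of _ "(z, k)"]) simp
  qed
  from bchoice[OF this] obtain zk where zk: "\<forall>j\<in>J. eligible u a j (fst (zk j)) (snd (zk j)) \<and>
      c j = Some (fst (zk j), 3 * rad (snd (zk j))) \<and> \<not> covered_by c {1..<j} (u j)"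
    by blast
  define z where "z j = fst (zk j)" for j
  define k where "k j = snd (zk j)" for j
  have el: "eligible u a j (z j) (k j)" and c: "c j = Some (z j, 3 * rad (k j))"
    and uncov: "\<not> covered_by c {1..<j} (u j)" if "j \<in> J" for j
    using zk that by (auto simp: z_def k_def)
  \<comment> \<open>\<open>B j\<close> collects the demands whose values pay for the cluster opened
    at \<open>j\<close>.\<close>
  define B where "B j = {i. i \<in> {1..j} \<and> d (u i) (z j) \<le> rad (k j)}" for j
  define L where "L = 2 + log 2 (real n)"
  have nonneg: "0 \<le> a i" if "i \<in> {1..n}" for i
    using pd_run_value[OF run that] f_pos by auto
  \<comment> \<open>A demand \<open>i\<close> pays for at most one cluster of each level.\<close>
  have inj: "inj_on k {j \<in> J. i \<in> B j}" for i
  proof (rule linorder_inj_onI)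
    fix j j' assume "j < j'" and j: "j \<in> {j \<in> J. i \<in> B j}" "j' \<in> {j \<in> J. i \<in> B j}"
    have M: "u i \<in> M" "u j' \<in> M" "z j \<in> M" "z j' \<in> M"
      using j u el by (auto simp: B_def J_def eligible_def Pi_iff)
    show "k j \<noteq> k j'"
    proof
      assume "k j = k j'"
      then have "d (u j') (z j') \<le> rad (k j)" "d (u i) (z j') \<le> rad (k j)" "d (u i) (z j) \<le> rad (k j)"
        using j el by (auto simp: B_def eligible_def)
      \<comment> \<open>The path from \<open>z j\<close> through \<open>u i\<close> and
        \<open>z j'\<close> to \<open>u j'\<close> has three legs of length at most
        \<open>rad (k j)\<close>; this is where the tripled radius is used.\<close>
      then have "d (z j) (u j') \<le> 3 * rad (k j)"
        using triangle[of "z j" "u i" "u j'"] triangle[of "u i" "z j'" "u j'"] M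
        by (simp add: commute)
      then have "u j' \<in> mcball (z j) (3 * rad (k j))" using M by simp
      then have "covered_by c {1..<j'} (u j')"
        using c[of j] j \<open>j < j'\<close> unfolding covered_by_def J_def by fastforce
      then show False using uncov j by blast
    qed
  qed auto
  have level: "k j \<in> {-1..\<lfloor>log 2 (real n)\<rfloor>}" if j: "j \<in> J" for j
  proof -
    have "j \<le> n" using j by (simp add: J_def)
    have e: "-1 \<le> k j" "tight u a j (z j) (k j)" using el[OF j] by (auto simp: eligible_def)
    have "real_of_int (k j) \<le> log 2 (real n)"
    proof (cases "k j < 0")
      \<comment> \<open>Level -1 is treated apart because its radius is 0 rather than a power of two
        times \<open>f\<close>; the bound follows from \<open>n\<close> \<ge> 1.\<close>
      case True
      then have "real_of_int (k j) \<le> 0" by simp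
      also have "0 \<le> log 2 (real n)" using n by simp
      finally show ?thesis .
    next
      case False
      then have "2 ^ nat (k j) \<le> n"
        using tight_level_le[OF pd_run_prefix[OF run \<open>j \<le> n\<close>] e(2)] \<open>j \<le> n\<close> by simp
      then have "real (nat (k j)) \<le> log 2 (real n)" by (rule le_log2_of_power)
      then show ?thesis using False by simp
    qed
    then show ?thesis using e(1) by (simp add: le_floor_iff)
  qed
  have card: "real (card {j \<in> J. i \<in> B j}) \<le> L" for i
  proof -
    have "card {j \<in> J. i \<in> B j} = card (k ` {j \<in> J. i \<in> B j})"
      using inj by (simp add: card_image)
    also have "\<dots> \<le> card {-1..\<lfloor>log 2 (real n)\<rfloor>}"
      by (rule card_mono) (use level in auto)
    \<comment> \<open>The levels -1 and 0 account for the summand 2 in \<open>L\<close>.\<close>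
    also have "real \<dots> = of_int \<lfloor>log 2 (real n)\<rfloor> + 2" using n by simp
    finally show ?thesis unfolding L_def by linarith
  qed
  have "pd_cost n c = (\<Sum>j\<in>J. f + 3 * rad (k j))"
    unfolding pd_cost_def
  proof (rule sum.mono_neutral_cong_right)
    show "\<forall>j\<in>{1..n} - J. (case c j of None \<Rightarrow> 0 | Some (p, r) \<Rightarrow> f + r) = 0"
      by (auto simp: J_def split: option.splits)
    show "(case c j of None \<Rightarrow> 0 | Some (p, r) \<Rightarrow> f + r) = f + 3 * rad (k j)" if "j \<in> J" for j
      using c[OF that] by simp
  qed (auto simp: J_def)
  also have "\<dots> \<le> (\<Sum>j\<in>J. 3 * sum a (B j))"
  proof (rule sum_mono)
    fix j assume "j \<in> J"
    then have "sum a (B j) = f + rad (k j)"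
      using el by (simp add: eligible_def tight_def B_def)
    then show "f + 3 * rad (k j) \<le> 3 * sum a (B j)" using f_pos by simp
  qed
  also have "\<dots> = 3 * (\<Sum>j\<in>J. \<Sum>i | i \<in> {1..n} \<and> i \<in> B j. a i)"
    unfolding sum_distrib_left[symmetric]
    by (intro arg_cong[where f = "(*) 3"] sum.cong) (auto simp: B_def J_def)
  \<comment> \<open>Double counting: the sum over opened clusters becomes a sum over demands, each
    weighted by the number of clusters it pays for, which is at most \<open>L\<close>.\<close>
  also have "(\<Sum>j\<in>J. \<Sum>i | i \<in> {1..n} \<and> i \<in> B j. a i) = (\<Sum>i=1..n. \<Sum>j | j \<in> J \<and> i \<in> B j. a i)"
    by (rule sum.swap_restrict) (auto simp: J_def)
  also have "\<dots> \<le> (\<Sum>i=1..n. L * a i)"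
    using card nonneg by (intro sum_mono) (auto intro: mult_right_mono)
  also have "\<dots> = L * (\<Sum>i=1..n. a i)" by (simp add: sum_distrib_left)
  also have "\<dots> \<le> L * pow2_opt n u"
  proof (rule mult_left_mono)
    obtain S where "offline_solution n u S" "pow2_radii S" "offline_cost S = pow2_opt n u"
      using pow2_opt_attained[OF u] by metis
    then show "(\<Sum>i=1..n. a i) \<le> pow2_opt n u"
      using sum_values_le_offline_cost[OF run u] by metis
    show "0 \<le> L" using n by (simp add: L_def)
  qed
  finally show ?thesis by (simp only: L_def mult.assoc)
qed

end

theorem theorem6:
  fixes M :: "'a set" and d :: "'a \<Rightarrow> 'a \<Rightarrow> real" and f :: real
    and n :: nat and u :: "nat \<Rightarrow> 'a"
    and a :: "nat \<Rightarrow> real" and c :: "nat \<Rightarrow> ('a \<times> real) option"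
  assumes "Metric_space M d" and "0 < f"
    and "1 \<le> n" and "u \<in> {1..n} \<rightarrow> M"
    and "online_sum_radii.pd_run M d f n u a c"
  shows "online_sum_radii.pd_cost f n c
    \<le> 3 * (2 + log 2 (real n)) * online_sum_radii.pow2_opt M d f n u"
proof -
  interpret online_sum_radii M d f
    using assms by (simp add: online_sum_radii_def online_sum_radii_axioms_def)
  show ?thesis using pd_cost_le_pow2_opt assms by blast
qed

end
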